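(* The following relations are satisfied for every convex body $K \subseteq \mathbb{R}^n$. (i) For all $\varepsilon_1, \varepsilon_2$ with $0 < \varepsilon_1 < \varepsilon_2$, $$c(K) \le c(K,\varepsilon_1) \le c(K,\varepsilon_2), \qquad i(K) \le i(K,\varepsilon_1) \le i(K,\varepsilon_2),$$ and $$c(K) \ge i(K), \qquad c(K,\varepsilon_1) \ge i(K,\varepsilon_1), \qquad c(K,\varepsilon_2) \ge i(K,\varepsilon_2).$$ (ii) $c(K) = \min_{\varepsilon > 0} c(K,\varepsilon)$. (iii) The circumradius $R(K)$ can be expressed as $$\sup\{\varepsilon > 0 : i(K,\varepsilon) < \infty\} = \sup\{\varepsilon > 0 : c(K,\varepsilon) < \infty\} = R(K).$$
   Context: A convex body $K \subseteq \mathbb{R}^n$ is a compact convex set with nonempty interior; $o$ is the origin, $\|\cdot\|$ is the Euclidean norm and $S^{n-1} = \{x \in \mathbb{R}^n : \|x\| = 1\}$. A vector $l \in \mathbb{R}^n \setminus \{o\}$ illuminates $x \in K$ if there exists $\varepsilon > 0$ with $x + \varepsilon l \in \mathrm{int}(K)$, and t-illuminates $x \in K$ if there exists $\varepsilon > 0$ with $x + \varepsilon l \in K$. Define $$c(K) = \min\{m : \exists l_1,\dots,l_m \in \mathbb{R}^n \setminus \{o\} \ \forall x \in K \ \exists i \ (l_i \text{ illuminates } x)\},$$ $$i(K) = \min\{m : \exists l_1,\dots,l_m \in \mathbb{R}^n \setminus \{o\} \ \forall x \in K \ \exists i \ (l_i \text{ t-illuminates } x)\}.$$ For $\varepsilon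 > 0$ define $$c(K,\varepsilon) = \min\{m : \exists r_1,\dots,r_m \in S^{n-1} \ \forall x \in K \ \exists i \ (x + \varepsilon r_i \in \mathrm{int}(K))\},$$ $$i(K,\varepsilon) = \min\{m : \exists r_1,\dots,r_m \in S^{n-1} \ \forall x \in K \ \exists i \ (x + \varepsilon r_i \in K)\},$$ where in each case the value is $\infty$ if no such $m$ exists. The circumradius $R(K)$ is the radius of the unique closed Euclidean ball of minimal radius containing $K$. *)

theory Defs
  imports "HOL-Analysis.Analysis" "HOL-Library.Extended_Nat"
begin

definition convex_body :: "'a::euclidean_space set \<Rightarrow> bool" where
  "convex_body K \<longleftrightarrow> compact K \<and> convex K \<and> interior K \<noteq> {}"

(* Both relations are used only for nonzero l. *)

definition illuminates :: "'a::euclidean_space set \<Rightarrow> 'a \<Rightarrow> 'a \<Rightarrow> bool" where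
  "illuminates K l x \<longleftrightarrow> (\<exists>\<epsilon>>0. x + \<epsilon> *\<^sub>R l \<in> interior K)"

definition t_illuminates :: "'a::euclidean_space set \<Rightarrow> 'a \<Rightarrow> 'a \<Rightarrow> bool" where
  "t_illuminates K l x \<longleftrightarrow> (\<exists>\<epsilon>>0. x + \<epsilon> *\<^sub>R l \<in> K)"

(* The minima are infima in enat: attained when some m is admissible, and \<infinity> otherwise. *)

definition c_num :: "'a::euclidean_space set \<Rightarrow> enat" where
  "c_num K = Inf {enat m |m. \<exists>l :: nat \<Rightarrow> 'a. (\<forall>i\<in>{1..m}. l i \<noteq> 0) \<and>
     (\<forall>x\<in>K. \<exists>i\<in>{1..m}. illuminates K (l i) x)}"

definition i_num :: "'a::euclidean_space set \<Rightarrow> enat" where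
  "i_num K = Inf {enat m |m. \<exists>l :: nat \<Rightarrow> 'a. (\<forall>i\<in>{1..m}. l i \<noteq> 0) \<and>
     (\<forall>x\<in>K. \<exists>i\<in>{1..m}. t_illuminates K (l i) x)}"

definition c_num_eps :: "'a::euclidean_space set \<Rightarrow> real \<Rightarrow> enat" where
  "c_num_eps K \<epsilon> = Inf {enat m |m. \<exists>r :: nat \<Rightarrow> 'a. (\<forall>i\<in>{1..m}. r i \<in> sphere 0 1) \<and>
     (\<forall>x\<in>K. \<exists>i\<in>{1..m}. x + \<epsilon> *\<^sub>R r i \<in> interior K)}"

definition i_num_eps :: "'a::euclidean_space set \<Rightarrow> real \<Rightarrow> enat" where
  "i_num_eps K \<epsilon> = Inf {enat m |m. \<exists>r :: nat \<Rightarrow> 'a. (\<forall>i\<in>{1..m}. r i \<in> sphere 0 1) \<and>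
     (\<forall>x\<in>K. \<exists>i\<in>{1..m}. x + \<epsilon> *\<^sub>R r i \<in> K)}"

definition min_enclosing_ball :: "'a::euclidean_space set \<Rightarrow> 'a \<Rightarrow> real \<Rightarrow> bool" where
  "min_enclosing_ball K z r \<longleftrightarrow> 0 \<le> r \<and> K \<subseteq> cball z r \<and>
     (\<forall>z' r'. 0 \<le> r' \<and> K \<subseteq> cball z' r' \<longrightarrow> r \<le> r')"

definition circumradius :: "'a::euclidean_space set \<Rightarrow> real" where
  "circumradius K = snd (THE (z, r). min_enclosing_ball K z r)"

end

theory Submission
  imports Defs
begin

text \<open>
  All four functionals count how many directions are required so that each point of \<open>K\<close> may be
  moved along one of them, and they differ only in the admissible directions and in the kind of
  movement.  Comparisons between them therefore reduce to converting a single direction that is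
  good for a single point (\<open>covering_number_le\<close>).

  Convexity drives the monotonicity in \<open>\<epsilon>\<close>: if \<open>x \<in> K\<close> and \<open>x + \<epsilon> r\<close> lies in \<open>K\<close> (or in its
  interior), then so does the shorter translate of \<open>x\<close>.

  The minimum in (ii) is attained by compactness.  If \<open>c(K)\<close> is infinite, so is every \<open>c(K,\<epsilon>)\<close>.
  Otherwise fix an optimal family of directions for \<open>c(K)\<close>, normalised to unit length.  For each \<open>\<epsilon>\<close> the points of \<open>K\<close> that the family moves into the
  interior with step length \<open>\<epsilon>\<close> form a relatively open set; these sets grow as \<open>\<epsilon>\<close> decreases and
  together exhaust \<open>K\<close>, so one of them is already \<open>K\<close>.

  For (iii), let \<open>R\<close> be the circumradius.  If \<open>\<epsilon> < R\<close>, no ball of radius \<open>\<epsilon>\<close> around a point \<open>x\<close>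
  of \<open>K\<close> contains \<open>K\<close>, so \<open>x\<close> can move by \<open>\<epsilon>\<close> towards some farther point of \<open>K\<close>, and even into the
  interior; compactness leaves finitely many directions.  Conversely, \<open>K\<close> lies in a ball of radius
  \<open>R\<close> around some point \<open>p\<close> of \<open>K\<close>, because projecting a centre onto \<open>K\<close> increases no distance
  to a point of \<open>K\<close>.  As no translation of \<open>p\<close> by more than \<open>R\<close> stays in \<open>K\<close>, finiteness for \<open>\<epsilon>\<close>
  forces \<open>\<epsilon> \<le> R\<close>.  The same projection confines the search for a smallest enclosing ball to
  centres in the compact set \<open>K\<close>, which gives existence; uniqueness is the parallelogram law.
\<close>

section \<open>Covering by directions\<close>

definition covering_number :: "'d set \<Rightarrow> ('d \<Rightarrow> 'a \<Rightarrow> bool) \<Rightarrow> 'a set \<Rightarrow> enat" where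
  "covering_number D P K = Inf {enat m |m. \<exists>l :: nat \<Rightarrow> 'd. (\<forall>i\<in>{1..m}. l i \<in> D) \<and>
     (\<forall>x\<in>K. \<exists>i\<in>{1..m}. P (l i) x)}"

lemma c_num_covering_number: "c_num K = covering_number (- {0}) (illuminates K) K"
  by (simp add: c_num_def covering_number_def)

lemma i_num_covering_number: "i_num K = covering_number (- {0}) (t_illuminates K) K"
  by (simp add: i_num_def covering_number_def)

lemma c_num_eps_covering_number:
  "c_num_eps K \<epsilon> = covering_number (sphere 0 1) (\<lambda>r x. x + \<epsilon> *\<^sub>R r \<in> interior K) K"
  by (simp add: c_num_eps_def covering_number_def)

lemma i_num_eps_covering_number:
  "i_num_eps K \<epsilon> = covering_number (sphere 0 1) (\<lambda>r x. x + \<epsilon> *\<^sub>R r \<in> K) K"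
  by (simp add: i_num_eps_def covering_number_def)

lemma covering_number_le_enat:
  assumes "\<forall>i\<in>{1..m}. l i \<in> D" "\<forall>x\<in>K. \<exists>i\<in>{1..m}. P (l i) x"
  shows "covering_number D P K \<le> enat m"
  unfolding covering_number_def using assms by (intro Inf_lower) auto

lemma covering_number_attained:
  assumes "covering_number D P K < \<infinity>"
  obtains m l where "covering_number D P K = enat m" "\<forall>i\<in>{1..m::nat}. l i \<in> D"
    "\<forall>x\<in>K. \<exists>i\<in>{1..m}. P (l i) x"
proof -
  let ?A = "{enat m |m. \<exists>l :: nat \<Rightarrow> _. (\<forall>i\<in>{1..m}. l i \<in> D) \<and> (\<forall>x\<in>K. \<exists>i\<in>{1..m}. P (l i) x)}"
  have "?A \<noteq> {}"
  proof
    assume "?A = {}"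
    then have "covering_number D P K = \<infinity>"
      by (simp only: covering_number_def Inf_enat_def simp_thms if_True)
    then show False
      using assms by simp
  qed
  then have "Inf ?A \<in> ?A"
    unfolding Inf_enat_def by (metis (no_types, lifting) LeastI ex_in_conv)
  then have "covering_number D P K \<in> ?A"
    by (simp only: covering_number_def)
  then show thesis
    using that by blast
qed

lemma covering_number_le:
  assumes "\<And>d. d \<in> D \<Longrightarrow> f d \<in> D'"
    and "\<And>d x. d \<in> D \<Longrightarrow> x \<in> K \<Longrightarrow> P d x \<Longrightarrow> P' (f d) x"
  shows "covering_number D' P' K \<le> covering_number D P K"
proof (cases "covering_number D P K < \<infinity>")
  case True
  then obtain m l where m: "covering_number D P K = enat m"
    and l: "\<forall>i\<in>{1..m::nat}. l i \<in> D" "\<forall>x\<in>K. \<exists>i\<in>{1..m}. P (l i) x"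
    by (rule covering_number_attained)
  have "covering_number D' P' K \<le> enat m"
    using l assms by (intro covering_number_le_enat[where l = "f \<circ> l"]) (simp, fastforce)
  then show ?thesis
    by (simp add: m)
qed simp

lemma covering_number_finite:
  assumes "finite F" "F \<subseteq> D" "\<And>x. x \<in> K \<Longrightarrow> \<exists>d\<in>F. P d x"
  shows "covering_number D P K < \<infinity>"
proof -
  obtain l where l: "bij_betw l {1..card F} F"
    using ex_bij_betw_nat_finite_1[OF assms(1)] by blast
  then have F: "F = l ` {1..card F}"
    by (simp add: bij_betw_def)
  have "covering_number D P K \<le> enat (card F)"
  proof (rule covering_number_le_enat[where l = l])
    show "\<forall>i\<in>{1..card F}. l i \<in> D"
      using F assms(2) by blast
    show "\<forall>x\<in>K. \<exists>i\<in>{1..card F}. P (l i) x"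
      using F assms(3) by (metis imageE)
  qed
  then show ?thesis
    by (rule le_less_trans) simp
qed

section \<open>Dependence on the step length\<close>

lemma convex_translate_shorter:
  fixes K :: "'a::real_vector set"
  assumes "convex K" "x \<in> K" "x + t *\<^sub>R r \<in> K" "0 < s" "s \<le> t"
  shows "x + s *\<^sub>R r \<in> K"
proof -
  have "(1 - s / t) *\<^sub>R x + (s / t) *\<^sub>R (x + t *\<^sub>R r) \<in> K"
    using assms by (intro convexD) auto
  moreover have "(1 - s / t) *\<^sub>R x + (s / t) *\<^sub>R (x + t *\<^sub>R r) = x + s *\<^sub>R r"
    using assms by (simp add: algebra_simps)
  ultimately show ?thesis
    by simp
qed

lemma interior_translate_shorter:
  fixes K :: "'a::euclidean_space set"
  assumes "convex K" "x \<in> K" "x + t *\<^sub>R r \<in> interior K" "0 < s" "s \<le> t"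
  shows "x + s *\<^sub>R r \<in> interior K"
proof -
  have "x - (s / t) *\<^sub>R (x - (x + t *\<^sub>R r)) \<in> interior K"
    using assms by (intro mem_interior_convex_shrink) auto
  then show ?thesis
    using assms by simp
qed

lemma c_num_eps_mono:
  assumes "convex K" "0 < s" "s \<le> t"
  shows "c_num_eps K s \<le> c_num_eps K t"
  unfolding c_num_eps_covering_number
  using interior_translate_shorter[OF assms(1) _ _ assms(2,3)]
  by (intro covering_number_le[where f = id]) auto

lemma i_num_eps_mono:
  assumes "convex K" "0 < s" "s \<le> t"
  shows "i_num_eps K s \<le> i_num_eps K t"
  unfolding i_num_eps_covering_number
  using convex_translate_shorter[OF assms(1) _ _ assms(2,3)]
  by (intro covering_number_le[where f = id]) auto

lemma c_num_le_c_num_eps: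
  assumes "0 < \<epsilon>"
  shows "c_num K \<le> c_num_eps K \<epsilon>"
  unfolding c_num_covering_number c_num_eps_covering_number
  using assms by (intro covering_number_le[where f = id]) (auto simp: illuminates_def)

lemma i_num_le_i_num_eps:
  assumes "0 < \<epsilon>"
  shows "i_num K \<le> i_num_eps K \<epsilon>"
  unfolding i_num_covering_number i_num_eps_covering_number
  using assms by (intro covering_number_le[where f = id]) (auto simp: t_illuminates_def)

lemma i_num_le_c_num: "i_num K \<le> c_num K"
  unfolding i_num_covering_number c_num_covering_number
  using interior_subset
  by (intro covering_number_le[where f = id]) (auto simp: illuminates_def t_illuminates_def)

lemma i_num_eps_le_c_num_eps: "i_num_eps K \<epsilon> \<le> c_num_eps K \<epsilon>"
  unfolding i_num_eps_covering_number c_num_eps_covering_number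
  using interior_subset by (intro covering_number_le[where f = id]) auto

text \<open>
  Each point of \<open>K\<close> comes with its own step length; a finite subcover of \<open>K\<close> supplies finitely many
  of them, and by convexity the least one serves for all points.
\<close>

lemma illuminating_family_uniform_step:
  fixes K :: "'a::euclidean_space set"
  assumes "compact K" "convex K" "K \<noteq> {}"
    and ill: "\<And>x. x \<in> K \<Longrightarrow> \<exists>r\<in>F. illuminates K r x"
  obtains \<epsilon> where "0 < \<epsilon>" "\<And>x. x \<in> K \<Longrightarrow> \<exists>r\<in>F. x + \<epsilon> *\<^sub>R r \<in> interior K"
proof -
  define U where "U e = (\<Union>r\<in>F. (\<lambda>x. x + e *\<^sub>R r) -` interior K)" for e :: real
  have "open (U e)" for e
    unfolding U_def by (intro open_UN ballI open_vimage continuous_intros open_interior)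
  moreover have "K \<subseteq> (\<Union>e\<in>{0<..}. U e)"
    using ill by (fastforce simp: U_def illuminates_def)
  ultimately obtain E where E: "E \<subseteq> {0<..}" "finite E" "K \<subseteq> (\<Union>e\<in>E. U e)"
    using compactE_image[OF assms(1), of "{0<..}" U] by metis
  then have "E \<noteq> {}"
    using assms(3) by auto
  then have "0 < Min E"
    using E by auto
  moreover have "\<exists>r\<in>F. x + Min E *\<^sub>R r \<in> interior K" if x: "x \<in> K" for x
  proof -
    obtain e r where "e \<in> E" "r \<in> F" "x + e *\<^sub>R r \<in> interior K"
      using E x by (auto simp: U_def)
    moreover have "Min E \<le> e"
      using E \<open>e \<in> E\<close> by simp
    ultimately show ?thesis
      using interior_translate_shorter[OF assms(2) x _ \<open>0 < Min E\<close>] by blast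
  qed
  ultimately show thesis
    using that by blast
qed

lemma illuminates_sgn:
  assumes "l \<noteq> 0" "illuminates K l x"
  shows "illuminates K (sgn l) x"
proof -
  obtain e where "0 < e" "x + e *\<^sub>R l \<in> interior K"
    using assms(2) by (auto simp: illuminates_def)
  then have "0 < e * norm l" "x + (e * norm l) *\<^sub>R sgn l \<in> interior K"
    using assms(1) by (simp_all add: sgn_div_norm mult.assoc)
  then show ?thesis
    unfolding illuminates_def by blast
qed

lemma c_num_attained_by_c_num_eps:
  fixes K :: "'a::euclidean_space set"
  assumes "compact K" "convex K" "K \<noteq> {}"
  shows "\<exists>\<epsilon>>0. c_num K = c_num_eps K \<epsilon>"
proof (cases "c_num K < \<infinity>")
  case True
  then obtain m l where m: "c_num K = enat m"
    and l: "\<forall>i\<in>{1..m::nat}. l i \<in> - {0}" "\<forall>x\<in>K. \<exists>i\<in>{1..m}. illuminates K (l i) x"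
    unfolding c_num_covering_number by (rule covering_number_attained)
  have "\<exists>r\<in>(sgn \<circ> l) ` {1..m}. illuminates K r x" if x: "x \<in> K" for x
    using l x illuminates_sgn by fastforce
  then obtain \<epsilon> where \<epsilon>: "0 < \<epsilon>"
    "\<And>x. x \<in> K \<Longrightarrow> \<exists>r\<in>(sgn \<circ> l) ` {1..m}. x + \<epsilon> *\<^sub>R r \<in> interior K"
    using illuminating_family_uniform_step[OF assms] by metis
  have "c_num_eps K \<epsilon> \<le> enat m"
    unfolding c_num_eps_covering_number
  proof (rule covering_number_le_enat[where l = "sgn \<circ> l"])
    show "\<forall>i\<in>{1..m}. (sgn \<circ> l) i \<in> sphere 0 1"
      using l(1) by (auto simp: norm_sgn)
    show "\<forall>x\<in>K. \<exists>i\<in>{1..m}. x + \<epsilon> *\<^sub>R (sgn \<circ> l) i \<in> interior K"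
      using \<epsilon>(2) by fastforce
  qed
  then show ?thesis
    using \<epsilon>(1) m c_num_le_c_num_eps[OF \<epsilon>(1), of K] by (metis antisym)
next
  case False
  then have "c_num K = c_num_eps K 1"
    using c_num_le_c_num_eps[of 1 K] by simp
  then show ?thesis
    using zero_less_one by blast
qed

section \<open>The circumradius\<close>

lemma recentre_in_convex:
  fixes K :: "'a::euclidean_space set"
  assumes "closed K" "convex K" "K \<noteq> {}" "K \<subseteq> cball z r"
  obtains p where "p \<in> K" "K \<subseteq> cball p r"
proof
  show "closest_point K z \<in> K"
    using assms by (intro closest_point_in_set)
  show "K \<subseteq> cball (closest_point K z) r"
  proof
    fix y assume y: "y \<in> K"
    have "dist (closest_point K z) y \<le> dist z y"
      using closest_point_lipschitz[OF assms(2,1,3), of z y] closest_point_self[OF y] by simp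
    then show "y \<in> cball (closest_point K z) r"
      using assms(4) y by auto
  qed
qed

text \<open>
  The pairs of a centre in \<open>K\<close> and an enclosing radius below an a priori bound form a compact set,
  on which the radius attains its minimum.
\<close>

lemma min_enclosing_ball_exists:
  fixes K :: "'a::euclidean_space set"
  assumes "compact K" "convex K" "K \<noteq> {}"
  shows "\<exists>z r. min_enclosing_ball K z r"
proof -
  obtain a where a: "a \<in> K"
    using assms(3) by blast
  obtain D where D: "0 < D" "K \<subseteq> cball a D"
    using bounded_subset_ballD[OF compact_imp_bounded[OF assms(1)], of a] ball_subset_cball
    by blast
  define A where "A = (K \<times> {0..D}) \<inter> (\<Inter>y\<in>K. {p. dist (fst p) y \<le> snd p})"
  have "closed (\<Inter>y\<in>K. {p :: 'a \<times> real. dist (fst p) y \<le> snd p})"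
    by (intro closed_INT ballI closed_Collect_le continuous_intros)
  then have "compact A"
    unfolding A_def using assms(1) by (intro compact_Int_closed compact_Times) auto
  moreover have "(a, D) \<in> A"
    using a D by (auto simp: A_def)
  moreover have "continuous_on A snd"
    by (intro continuous_intros)
  ultimately obtain p where p: "p \<in> A" and min: "\<And>q. q \<in> A \<Longrightarrow> snd p \<le> snd q"
    using continuous_attains_inf[of A snd] by blast
  have "snd p \<le> r'" if r': "0 \<le> r'" "K \<subseteq> cball z' r'" for z' r'
  proof (cases "r' \<le> D")
    case True
    obtain q where "q \<in> K" "K \<subseteq> cball q r'"
      using recentre_in_convex[OF compact_imp_closed[OF assms(1)] assms(2,3) r'(2)] .
    then have "(q, r') \<in> A"
      using r'(1) True by (auto simp: A_def)
    then show ?thesis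
      using min by fastforce
  next
    case False
    then show ?thesis
      using p by (auto simp: A_def)
  qed
  moreover have "0 \<le> snd p" "K \<subseteq> cball (fst p) (snd p)"
    using p by (auto simp: A_def)
  ultimately have "min_enclosing_ball K (fst p) (snd p)"
    unfolding min_enclosing_ball_def by blast
  then show ?thesis
    by blast
qed

text \<open>
  By the parallelogram law, the intersection of two balls of equal radius with distinct centres
  lies in a smaller ball around the midpoint.
\<close>

lemma min_enclosing_ball_unique:
  fixes K :: "'a::euclidean_space set"
  assumes "K \<noteq> {}" and B: "min_enclosing_ball K z r" and B': "min_enclosing_ball K z' r'"
  shows "z = z'" "r = r'"
proof -
  show r: "r = r'"
    using B B' unfolding min_enclosing_ball_def by (meson antisym)
  define s where "s = r\<^sup>2 - (norm (z - z') / 2)\<^sup>2"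
  have mid: "(norm (y - midpoint z z'))\<^sup>2 \<le> s" if y: "y \<in> K" for y
  proof -
    have "norm (y - z) \<le> r" "norm (y - z') \<le> r"
      using B B' y r by (auto simp: min_enclosing_ball_def dist_norm norm_minus_commute)
    then have le: "(norm (y - z))\<^sup>2 \<le> r\<^sup>2" "(norm (y - z'))\<^sup>2 \<le> r\<^sup>2"
      by (auto intro: power_mono)
    have "y - midpoint z z' = (1/2) *\<^sub>R ((y - z) + (y - z'))"
      by (simp add: midpoint_def scaleR_2[symmetric] algebra_simps)
    then have n: "(norm (y - midpoint z z'))\<^sup>2 = (norm ((y - z) + (y - z')))\<^sup>2 / 4"
      by (simp add: power_divide)
    have "z - z' = (y - z') - (y - z)"
      by simp
    then have "(norm (z - z'))\<^sup>2 + (norm ((y - z) + (y - z')))\<^sup>2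
        = 2 * (norm (y - z))\<^sup>2 + 2 * (norm (y - z'))\<^sup>2"
      by (simp only: power2_norm_eq_inner) (simp add: inner_commute algebra_simps)
    then show ?thesis
      using le n by (simp add: s_def power_divide)
  qed
  then have "0 \<le> s"
    using assms(1) by (metis ex_in_conv order_trans zero_le_power2)
  have "K \<subseteq> cball (midpoint z z') (sqrt s)"
    using mid by (auto simp: dist_norm norm_minus_commute real_le_rsqrt)
  then have "r \<le> sqrt s"
    using B \<open>0 \<le> s\<close> unfolding min_enclosing_ball_def by (meson real_sqrt_ge_zero)
  moreover have "0 \<le> r"
    using B by (simp add: min_enclosing_ball_def)
  ultimately have "r\<^sup>2 \<le> s"
    using \<open>0 \<le> s\<close> by (metis power_mono real_sqrt_pow2)
  then show "z = z'"
    by (simp add: s_def)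
qed

lemma min_enclosing_ball_circumradius:
  fixes K :: "'a::euclidean_space set"
  assumes "compact K" "convex K" "K \<noteq> {}"
  obtains z where "min_enclosing_ball K z (circumradius K)"
proof -
  obtain z r where B: "min_enclosing_ball K z r"
    using min_enclosing_ball_exists[OF assms] by blast
  have "(THE (z, r). min_enclosing_ball K z r) = (z, r)"
  proof (rule the_equality)
    show "case (z, r) of (z, r) \<Rightarrow> min_enclosing_ball K z r"
      using B by simp
    show "q = (z, r)" if "case q of (z, r) \<Rightarrow> min_enclosing_ball K z r" for q
      using that min_enclosing_ball_unique[OF assms(3) _ B] by (cases q) simp
  qed
  then have "circumradius K = r"
    by (simp add: circumradius_def)
  then show thesis
    using B that by simp
qed

lemma circumradius_pos:
  fixes K :: "'a::euclidean_space set"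
  assumes "convex_body K"
  shows "0 < circumradius K"
proof -
  have K: "compact K" "convex K" "interior K \<noteq> {}" "K \<noteq> {}"
    using assms interior_subset by (auto simp: convex_body_def)
  obtain z where z: "min_enclosing_ball K z (circumradius K)"
    using min_enclosing_ball_circumradius K by blast
  have "circumradius K \<noteq> 0"
  proof
    assume "circumradius K = 0"
    then have "K \<subseteq> {z}"
      using z by (simp add: min_enclosing_ball_def)
    then have "interior K \<subseteq> interior {z}"
      by (rule interior_mono)
    then show False
      using K(3) by simp
  qed
  then show ?thesis
    using z by (simp add: min_enclosing_ball_def)
qed

section \<open>Finiteness below and only below the circumradius\<close>

text \<open>
  A unit direction that moves \<open>x\<close> by \<open>\<epsilon>\<close> into the interior of \<open>K\<close> does so for all points near
  \<open>x\<close>, so compactness reduces the claim to finding one direction for each point.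
\<close>

lemma c_num_eps_finite:
  fixes K :: "'a::euclidean_space set"
  assumes "convex_body K" "0 < \<epsilon>" "\<epsilon> < circumradius K"
  shows "c_num_eps K \<epsilon> < \<infinity>"
proof -
  have K: "compact K" "convex K" "interior K \<noteq> {}" "K \<noteq> {}"
    using assms(1) interior_subset by (auto simp: convex_body_def)
  obtain z where z: "min_enclosing_ball K z (circumradius K)"
    using min_enclosing_ball_circumradius K by blast
  define U where "U r = (\<lambda>x. x + \<epsilon> *\<^sub>R r) -` interior K" for r :: 'a
  have "open (U r)" for r
    unfolding U_def by (intro open_vimage continuous_intros open_interior)
  moreover have "K \<subseteq> (\<Union>r\<in>sphere 0 1. U r)"
  proof
    fix x assume x: "x \<in> K"
    \<comment> \<open>A point of \<open>K\<close> farther than \<open>\<epsilon>\<close> from \<open>x\<close> is a limit of interior points, which are then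
       also farther than \<open>\<epsilon>\<close>.\<close>
    have "interior K - cball x \<epsilon> \<noteq> {}"
    proof
      assume "interior K - cball x \<epsilon> = {}"
      then have "closure (interior K) \<subseteq> cball x \<epsilon>"
        by (intro closure_minimal) auto
      then have "K \<subseteq> cball x \<epsilon>"
        using convex_closure_interior[OF K(2,3)] closure_subset by blast
      then have "circumradius K \<le> \<epsilon>"
        using z assms(2) unfolding min_enclosing_ball_def by (meson less_imp_le)
      then show False
        using assms(3) by simp
    qed
    then obtain y where "y \<in> interior K" "y \<notin> cball x \<epsilon>"
      by blast
    then have y: "y \<in> interior K" "\<epsilon> < norm (y - x)"
      by (simp_all add: dist_norm norm_minus_commute)
    then have "y \<noteq> x"
      using assms(2) by auto
    then have "x + norm (y - x) *\<^sub>R sgn (y - x) \<in> interior K"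
      using y(1) by (simp add: sgn_div_norm)
    then have "x + \<epsilon> *\<^sub>R sgn (y - x) \<in> interior K"
      using interior_translate_shorter[OF K(2) x] y(2) assms(2) by (meson less_imp_le)
    then show "x \<in> (\<Union>r\<in>sphere 0 1. U r)"
      using \<open>y \<noteq> x\<close> by (auto simp: U_def norm_sgn intro!: bexI[of _ "sgn (y - x)"])
  qed
  ultimately obtain F where "F \<subseteq> sphere 0 1" "finite F" "K \<subseteq> (\<Union>r\<in>F. U r)"
    using compactE_image[OF K(1), of "sphere 0 1" U] by metis
  then show ?thesis
    unfolding c_num_eps_covering_number by (intro covering_number_finite) (auto simp: U_def)
qed

lemma i_num_eps_finite_imp_le_circumradius:
  fixes K :: "'a::euclidean_space set"
  assumes "compact K" "convex K" "K \<noteq> {}" "i_num_eps K \<epsilon> < \<infinity>"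
  shows "\<epsilon> \<le> circumradius K"
proof -
  obtain z where "min_enclosing_ball K z (circumradius K)"
    using min_enclosing_ball_circumradius assms by blast
  then have "K \<subseteq> cball z (circumradius K)"
    by (simp add: min_enclosing_ball_def)
  then obtain p where p: "p \<in> K" "K \<subseteq> cball p (circumradius K)"
    by (rule recentre_in_convex[OF compact_imp_closed[OF assms(1)] assms(2,3)])
  obtain r where "norm r = 1" "p + \<epsilon> *\<^sub>R r \<in> K"
    using assms(4) p(1) unfolding i_num_eps_covering_number
    by (elim covering_number_attained) (metis mem_sphere_0)
  then have "dist p (p + \<epsilon> *\<^sub>R r) \<le> circumradius K" "dist p (p + \<epsilon> *\<^sub>R r) = \<bar>\<epsilon>\<bar>"
    using p(2) by (auto simp: dist_norm)
  then show ?thesis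
    by simp
qed

section \<open>Monotonicity, minimum and circumradius formula\<close>

theorem theorem4p1:
  fixes K :: "(real ^ 'n) set"
  assumes "convex_body K"
  shows
    "(\<forall>\<epsilon>1 \<epsilon>2. 0 < \<epsilon>1 \<and> \<epsilon>1 < \<epsilon>2 \<longrightarrow>
        c_num K \<le> c_num_eps K \<epsilon>1 \<and> c_num_eps K \<epsilon>1 \<le> c_num_eps K \<epsilon>2 \<and>
        i_num K \<le> i_num_eps K \<epsilon>1 \<and> i_num_eps K \<epsilon>1 \<le> i_num_eps K \<epsilon>2 \<and>
        c_num K \<ge> i_num K \<and>
        c_num_eps K \<epsilon>1 \<ge> i_num_eps K \<epsilon>1 \<and>
        c_num_eps K \<epsilon>2 \<ge> i_num_eps K \<epsilon>2) \<and>
     ((\<exists>\<epsilon>>0. c_num K = c_num_eps K \<epsilon>) \<and> (\<forall>\<epsilon>>0. c_num K \<le> c_num_eps K \<epsilon>)) \<and>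
     (SUP \<epsilon>\<in>{\<epsilon>. 0 < \<epsilon> \<and> i_num_eps K \<epsilon> < \<infinity>}. ereal \<epsilon>)
       = (SUP \<epsilon>\<in>{\<epsilon>. 0 < \<epsilon> \<and> c_num_eps K \<epsilon> < \<infinity>}. ereal \<epsilon>) \<and>
     (SUP \<epsilon>\<in>{\<epsilon>. 0 < \<epsilon> \<and> c_num_eps K \<epsilon> < \<infinity>}. ereal \<epsilon>) = ereal (circumradius K)"
proof (intro conjI)
  have K: "compact K" "convex K" "K \<noteq> {}"
    using assms interior_subset by (auto simp: convex_body_def)
  let ?I = "{\<epsilon>. 0 < \<epsilon> \<and> i_num_eps K \<epsilon> < \<infinity>}"
  let ?C = "{\<epsilon>. 0 < \<epsilon> \<and> c_num_eps K \<epsilon> < \<infinity>}"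
  show "\<forall>\<epsilon>1 \<epsilon>2. 0 < \<epsilon>1 \<and> \<epsilon>1 < \<epsilon>2 \<longrightarrow>
        c_num K \<le> c_num_eps K \<epsilon>1 \<and> c_num_eps K \<epsilon>1 \<le> c_num_eps K \<epsilon>2 \<and>
        i_num K \<le> i_num_eps K \<epsilon>1 \<and> i_num_eps K \<epsilon>1 \<le> i_num_eps K \<epsilon>2 \<and>
        c_num K \<ge> i_num K \<and>
        c_num_eps K \<epsilon>1 \<ge> i_num_eps K \<epsilon>1 \<and>
        c_num_eps K \<epsilon>2 \<ge> i_num_eps K \<epsilon>2"
    using K(2) by (simp add: c_num_le_c_num_eps i_num_le_i_num_eps c_num_eps_mono i_num_eps_mono
        i_num_le_c_num i_num_eps_le_c_num_eps)
  show "\<exists>\<epsilon>>0. c_num K = c_num_eps K \<epsilon>"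
    using c_num_attained_by_c_num_eps[OF K] .
  show "\<forall>\<epsilon>>0. c_num K \<le> c_num_eps K \<epsilon>"
    by (simp add: c_num_le_c_num_eps)
  have I: "(SUP \<epsilon>\<in>?I. ereal \<epsilon>) \<le> ereal (circumradius K)"
    using i_num_eps_finite_imp_le_circumradius[OF K] by (intro SUP_least) simp
  have CI: "(SUP \<epsilon>\<in>?C. ereal \<epsilon>) \<le> (SUP \<epsilon>\<in>?I. ereal \<epsilon>)"
    using i_num_eps_le_c_num_eps[of K]
    by (intro SUP_subset_mono subsetI CollectI) (blast intro: le_less_trans, simp)
  have C: "ereal (circumradius K) \<le> (SUP \<epsilon>\<in>?C. ereal \<epsilon>)"
  proof (rule dense_le_bounded)
    show "0 < ereal (circumradius K)"
      using circumradius_pos[OF assms] by simp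
    fix t assume t: "0 < t" "t < ereal (circumradius K)"
    then obtain \<epsilon> where \<epsilon>: "t = ereal \<epsilon>"
      by (cases t) auto
    then have "\<epsilon> \<in> ?C"
      using t c_num_eps_finite[OF assms] by simp
    then show "t \<le> (SUP \<epsilon>\<in>?C. ereal \<epsilon>)"
      unfolding \<epsilon> by (rule SUP_upper)
  qed
  show "(SUP \<epsilon>\<in>?I. ereal \<epsilon>) = (SUP \<epsilon>\<in>?C. ereal \<epsilon>)"
    using I CI C by (meson antisym order_trans)
  show "(SUP \<epsilon>\<in>?C. ereal \<epsilon>) = ereal (circumradius K)"
    using I CI C by (meson antisym order_trans)
qed

end
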